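(* Let $X_0$ be a random initial state independent of $\sigma(Y_n,\varepsilon_{n+1}\mid n\in\mathbb{N})$ and let $X_{t+1}=f(X_t,Y_t,\varepsilon_{t+1})$, $t\in\mathbb{N}$. Assume that the iteration satisfies the coupling condition with some $x_0\in\mathcal{X}$, i.e. $$b(n):=\sup_{j\in\mathbb{N}}\mathbb{P}\left(Z_{j,j+n}^{X_j}\neq Z_{j,j+n}^{x_0}\right)\to 0\quad\text{as } n\to\infty.$$ Then for all integers $0\le m<n$, $$\alpha^X(n)\le \alpha^{\tilde Y}(m+1)+b(n-m),$$ where $\tilde Y_n=(Y_n,\varepsilon_{n+1})$, $n\in\mathbb{N}$.
   Context: $\mathbb{N}=\{0,1,2,\dots\}$. $\mathcal{X},\mathcal{Y}$ are complete separable metric spaces, $f:\mathcal{X}\times\mathcal{Y}\times[0,1]\to\mathcal{X}$ is measurable, $(Y_t)_{t\in\mathbb{N}}$ is a $\mathcal{Y}$-valued process and $(\varepsilon_t)_{t\ge 1}$ a $[0,1]$-valued process on a probability space $(\Omega,\mathcal{F},\mathbb{P})$ (no independence or stationarity of these is assumed). For $x\in\mathcal{X}$ (possibly random) and $s\in\mathbb N$: $Z_{s,t}^{x}=x$ if $t\le s$, and $Z_{s,t}^{x}=f(Z_{s,t-1}^{x},Y_{t-1},\varepsilon_t)$ if $t>s$. (So $Z_{s,t}^{X_s}=X_t$ for $t\ge s$.) For sub-$\sigma$-algebras $\mathcal{G},\mathcal{H}\subset\mathcal{F}$, $\alpha(\mathcal{G},\mathcal{H})=\sup_{G\in\mathcal{G},H\in\mathcal{H}}|\mathbb{P}(G\cap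 H)-\mathbb{P}(G)\mathbb{P}(H)|$. For a process $(W_t)_{t\in\mathbb{N}}$, $\alpha^W(n)=\sup_{j\in\mathbb{N}}\alpha\big(\sigma(W_k, 0\le k\le j),\sigma(W_k,k\ge j+n)\big)$. *)

theory Defs
  imports "HOL-Probability.Probability"
begin

definition sigma_process ::
  "'w measure \<Rightarrow> (nat \<Rightarrow> 'w \<Rightarrow> 'b::topological_space) \<Rightarrow> nat set \<Rightarrow> 'w set set"
  where "sigma_process M W I =
    sigma_sets (space M) (\<Union>k\<in>I. {W k -` A \<inter> space M | A. A \<in> sets borel})"

definition alpha_sigma :: "'w measure \<Rightarrow> 'w set set \<Rightarrow> 'w set set \<Rightarrow> real"
  where "alpha_sigma M \<G> \<H> =
    (SUP (G, H)\<in>\<G> \<times> \<H>. \<bar>measure M (G \<inter> H) - measure M G * measure M H\<bar>)"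

definition alpha_mixing ::
  "'w measure \<Rightarrow> (nat \<Rightarrow> 'w \<Rightarrow> 'b::topological_space) \<Rightarrow> nat \<Rightarrow> real"
  where "alpha_mixing M W n =
    (SUP j. alpha_sigma M (sigma_process M W {0..j}) (sigma_process M W {j + n..}))"

text \<open>
  The initial state \<open>x\<close> may be random, so it is a function on the sample space; a deterministic
  state is a constant function.  The value \<open>\<epsilon> 0\<close> is never used.
\<close>

fun Z_iter ::
  "('x \<Rightarrow> 'y \<Rightarrow> real \<Rightarrow> 'x) \<Rightarrow> (nat \<Rightarrow> 'w \<Rightarrow> 'y) \<Rightarrow> (nat \<Rightarrow> 'w \<Rightarrow> real)
    \<Rightarrow> ('w \<Rightarrow> 'x) \<Rightarrow> nat \<Rightarrow> nat \<Rightarrow> 'w \<Rightarrow> 'x"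
  where "Z_iter f Y \<epsilon> x s t \<omega> =
    (if t \<le> s then x \<omega> else f (Z_iter f Y \<epsilon> x s (t - 1) \<omega>) (Y (t - 1) \<omega>) (\<epsilon> t \<omega>))"

declare Z_iter.simps [simp del]

definition coupling_bound ::
  "'w measure \<Rightarrow> ('x \<Rightarrow> 'y \<Rightarrow> real \<Rightarrow> 'x) \<Rightarrow> (nat \<Rightarrow> 'w \<Rightarrow> 'y) \<Rightarrow> (nat \<Rightarrow> 'w \<Rightarrow> real)
    \<Rightarrow> (nat \<Rightarrow> 'w \<Rightarrow> 'x) \<Rightarrow> 'x \<Rightarrow> nat \<Rightarrow> real"
  where "coupling_bound M f Y \<epsilon> X x\<^sub>0 n =
    (SUP j. measure M {\<omega> \<in> space M.
       Z_iter f Y \<epsilon> (X j) j (j + n) \<omega> \<noteq> Z_iter f Y \<epsilon> (\<lambda>_. x\<^sub>0) j (j + n) \<omega>})"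

end

theory Submission
  imports Defs
begin

text \<open>
  Restart the iteration from \<open>x\<^sub>0\<close> at time \<open>j + m\<close>.  Outside an event of probability at most
  \<open>b (n - m)\<close> the restarted path equals \<open>X\<close> from time \<open>j + n\<close> on, so every future event \<open>H\<close> of \<open>X\<close>
  may be replaced by an event \<open>H'\<close> of the inputs \<open>Yt k\<close> with \<open>k \<ge> j + m\<close>, at the cost \<open>b (n - m)\<close>.
  A past event of \<open>X\<close> depends on \<open>X 0\<close> and on \<open>Yt k\<close> with \<open>k \<le> j - 1\<close>.  Since \<open>X 0\<close> is
  independent of all inputs, conditioning on it leaves the mixing coefficient of \<open>Yt\<close> at the gap
  \<open>m + 1\<close>.
\<close>

section \<open>Sigma-algebras generated by a process\<close>

lemma sigma_algebra_sigma_process: "sigma_algebra (space M) (sigma_process M W I)"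
  unfolding sigma_process_def by (rule sigma_algebra_sigma_sets) auto

text \<open>Wrapping the bare set system as a measure space allows membership in it to be argued
  through measurability of maps; only its space and its sets matter.\<close>

abbreviation process_algebra ::
  "'w measure \<Rightarrow> (nat \<Rightarrow> 'w \<Rightarrow> 'b::topological_space) \<Rightarrow> nat set \<Rightarrow> 'w measure"
  where "process_algebra M W I \<equiv> sigma (space M) (sigma_process M W I)"

lemma sets_process_algebra [simp]: "sets (process_algebra M W I) = sigma_process M W I"
  by (rule sigma_algebra.sets_measure_of_eq[OF sigma_algebra_sigma_process])

lemma space_process_algebra [simp]: "space (process_algebra M W I) = space M"
  by (rule space_measure_of_conv)

lemma measurable_process_algebra:
  assumes "k \<in> I"
  shows "W k \<in> process_algebra M W I \<rightarrow>\<^sub>M borel"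
proof (rule measurableI)
  fix A :: "'b set" assume "A \<in> sets borel"
  then have "W k -` A \<inter> space M \<in> sigma_process M W I"
    unfolding sigma_process_def using assms by (intro sigma_sets.Basic) blast
  then show "W k -` A \<inter> space (process_algebra M W I) \<in> sets (process_algebra M W I)"
    by simp
qed simp

text \<open>Minimality of the generated sigma-algebra. It later carries events of \<open>X\<close>
  and of the restarted path over to the variables that drive them.\<close>

lemma sigma_process_subset:
  assumes "\<And>k. k \<in> I \<Longrightarrow> W k \<in> N \<rightarrow>\<^sub>M borel" "space N = space M"
  shows "sigma_process M W I \<subseteq> sets N"
  unfolding sigma_process_def assms(2)[symmetric]
  by (rule sets.sigma_sets_subset) (use assms(1) in \<open>auto intro: measurable_sets\<close>)

lemma sigma_process_mono: "I \<subseteq> J \<Longrightarrow> sigma_process M W I \<subseteq> sigma_process M W J"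
  using sigma_process_subset[of I W "process_algebra M W J" M]
  by (force intro: measurable_process_algebra)

section \<open>Covariances of events and mixing coefficients\<close>

context prob_space
begin

lemma abs_indicator_minus_prob_le_1: "\<bar>indicator A x - prob B\<bar> \<le> 1"
  using measure_nonneg[of M B] prob_le_1[of B] by (auto simp: indicator_def)

text \<open>This bound makes the real suprema in \<open>alpha_sigma\<close> and
  \<open>alpha_mixing\<close> bounded above, so that they dominate their members.\<close>

lemma abs_cov_le_1:
  "\<bar>prob (A \<inter> B) - prob A * prob B\<bar> \<le> 1"
proof -
  have "0 \<le> prob A * prob B" "prob A * prob B \<le> 1"
    by (auto intro: mult_le_one)
  moreover have "0 \<le> prob (A \<inter> B)" "prob (A \<inter> B) \<le> 1" by auto
  ultimately show ?thesis by linarith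
qed

lemma alpha_sigma_upper:
  assumes "G \<in> \<G>" "H \<in> \<H>"
  shows "\<bar>prob (G \<inter> H) - prob G * prob H\<bar> \<le> alpha_sigma M \<G> \<H>"
  unfolding alpha_sigma_def
  by (rule cSUP_upper2[of _ _ "(G, H)"]) (auto simp: assms intro!: bdd_aboveI[of _ 1] abs_cov_le_1)

text \<open>The memberships of \<open>{}\<close> make the index set nonempty, as a least upper bound
  in the reals requires.\<close>

lemma alpha_sigma_least:
  assumes "{} \<in> \<G>" "{} \<in> \<H>"
    and "\<And>G H. G \<in> \<G> \<Longrightarrow> H \<in> \<H> \<Longrightarrow> \<bar>prob (G \<inter> H) - prob G * prob H\<bar> \<le> c"
  shows "alpha_sigma M \<G> \<H> \<le> c"
  unfolding alpha_sigma_def by (rule cSUP_least) (use assms in auto)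

lemma empty_in_sigma_process: "{} \<in> sigma_process N W I"
  unfolding sigma_process_def by (rule sigma_sets.Empty)

lemma alpha_mixing_upper:
  "alpha_sigma M (sigma_process M W {0..j}) (sigma_process M W {j + n..}) \<le> alpha_mixing M W n"
  unfolding alpha_mixing_def
  by (rule cSUP_upper)
    (auto intro!: bdd_aboveI[of _ 1] alpha_sigma_least empty_in_sigma_process abs_cov_le_1)

text \<open>A pair of empty events contributes covariance 0 to the supremum.\<close>

lemma alpha_mixing_nonneg: "0 \<le> alpha_mixing M W n"
  using alpha_sigma_upper[OF empty_in_sigma_process empty_in_sigma_process] alpha_mixing_upper
  by (smt (verit))

lemma prob_diff_le_coupling_bound:
  "prob {\<omega> \<in> space M. Z_iter f Y \<epsilon> (X j) j (j + n) \<omega> \<noteq> Z_iter f Y \<epsilon> (\<lambda>_. x) j (j + n) \<omega>}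
    \<le> coupling_bound M f Y \<epsilon> X x n"
  unfolding coupling_bound_def by (rule cSUP_upper) (auto intro!: bdd_aboveI[of _ 1])

text \<open>
  The covariance is the integral of \<open>(indicator G - prob G) * indicator H\<close>, whose first factor is
  bounded by \<open>1\<close>; expanding the difference by the triangle inequality would lose a factor \<open>2\<close>.
\<close>
lemma cov_perturb:
  assumes [measurable]: "G \<in> events" "H \<in> events" "H' \<in> events" "D \<in> events"
    and eq: "H - D = H' - D"
  shows "\<bar>prob (G \<inter> H) - prob G * prob H\<bar> \<le> \<bar>prob (G \<inter> H') - prob G * prob H'\<bar> + prob D"
proof -
  let ?g = "\<lambda>\<omega>. indicator G \<omega> - prob G"
  have cov: "(\<integral>\<omega>. ?g \<omega> * indicator K \<omega> \<partial>M) = prob (G \<inter> K) - prob G * prob K"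
    if [measurable]: "K \<in> events" for K
  proof -
    have "(\<integral>\<omega>. ?g \<omega> * indicator K \<omega> \<partial>M)
        = (\<integral>\<omega>. indicator (G \<inter> K) \<omega> - prob G * indicator K \<omega> \<partial>M)"
      by (simp add: left_diff_distrib indicator_inter_arith)
    also have "\<dots> = prob (G \<inter> K) - prob G * prob K"
      by (subst Bochner_Integration.integral_diff) (auto simp: emeasure_eq_measure)
    finally show ?thesis .
  qed
  have int: "integrable M (\<lambda>\<omega>. ?g \<omega> * indicator K \<omega>)" if [measurable]: "K \<in> events" for K
    by (rule integrable_const_bound[of _ 1])
      (auto simp: abs_mult intro!: AE_I2 mult_le_one abs_indicator_minus_prob_le_1)
  have "\<bar>(\<integral>\<omega>. ?g \<omega> * indicator H \<omega> \<partial>M) - (\<integral>\<omega>. ?g \<omega> * indicator H' \<omega> \<partial>M)\<bar>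
      = \<bar>\<integral>\<omega>. ?g \<omega> * indicator H \<omega> - ?g \<omega> * indicator H' \<omega> \<partial>M\<bar>"
    by (simp add: int)
  also have "\<dots> \<le> (\<integral>\<omega>. \<bar>?g \<omega> * indicator H \<omega> - ?g \<omega> * indicator H' \<omega>\<bar> \<partial>M)"
    by (rule integral_abs_bound)
  \<comment> \<open>Off \<open>D\<close> the two indicators agree and the integrand vanishes; on
    \<open>D\<close> they differ by at most 1, so the bound 1 on the first factor suffices.\<close>
  also have "\<dots> \<le> (\<integral>\<omega>. indicator D \<omega> \<partial>M)"
  proof (rule integral_mono)
    fix \<omega>
    have "\<omega> \<in> H \<longleftrightarrow> \<omega> \<in> H'" if "\<omega> \<notin> D" using eq that by blast
    then show "\<bar>?g \<omega> * indicator H \<omega> - ?g \<omega> * indicator H' \<omega>\<bar> \<le> indicator D \<omega>"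
      by (cases "\<omega> \<in> D") (use abs_indicator_minus_prob_le_1[of G \<omega> G] in \<open>auto simp: indicator_def\<close>)
  qed (auto intro!: integrable_abs Bochner_Integration.integrable_diff int simp: emeasure_eq_measure)
  also have "\<dots> = prob D" by simp
  finally show ?thesis by (simp add: cov)
qed

text \<open>
  By independence the diagonal map sends the probability to a product measure, so the covariance
  of \<open>G\<close> and \<open>H\<close> is an average over \<open>\<A>\<close> of covariances of sections of \<open>G\<close> with \<open>H\<close>.
\<close>
lemma cov_le_join_indep:
  assumes indep: "indep_set \<A> \<B>"
    and sa: "sigma_algebra (space M) \<A>" "sigma_algebra (space M) \<B>" "sigma_algebra (space M) \<V>"
    and "\<V> \<subseteq> \<B>" and H: "H \<in> \<B>" and G: "G \<in> sigma_sets (space M) (\<A> \<union> \<V>)"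
    and le: "\<And>V. V \<in> \<V> \<Longrightarrow> \<bar>prob (V \<inter> H) - prob V * prob H\<bar> \<le> c"
  shows "\<bar>prob (G \<inter> H) - prob G * prob H\<bar> \<le> c"
proof -
  define MA where "MA = sigma (space M) \<A>"
  define MB where "MB = sigma (space M) \<B>"
  define MV where "MV = sigma (space M) \<V>"
  have sets [simp]: "sets MA = \<A>" "sets MB = \<B>" "sets MV = \<V>"
    unfolding MA_def MB_def MV_def
    by (simp_all add: sa sigma_algebra.sets_measure_of_eq)
  have space [simp]: "space MA = space M" "space MB = space M" "space MV = space M"
    by (simp_all add: MA_def MB_def MV_def space_measure_of_conv)
  have sub: "\<A> \<subseteq> events" "\<B> \<subseteq> events"
    using indep by (auto simp: indep_sets2_eq)
  have [measurable]: "(\<lambda>x. x) \<in> M \<rightarrow>\<^sub>M MA" "(\<lambda>x. x) \<in> M \<rightarrow>\<^sub>M MB"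
    using sub by (auto intro!: measurableI sets.Int_space_eq2 simp: Int_absorb2 sets.sets_into_space subset_iff)
  have BV: "(\<lambda>x. x) \<in> MB \<rightarrow>\<^sub>M MV"
    using \<open>\<V> \<subseteq> \<B>\<close> sets.sets_into_space[of _ MV] by (auto intro!: measurableI simp: Int_absorb2)
  define DA where "DA = distr M MA (\<lambda>x. x)"
  define DB where "DB = distr M MB (\<lambda>x. x)"
  interpret A: prob_space DA unfolding DA_def by (rule prob_space_distr) simp
  interpret B: prob_space DB unfolding DB_def by (rule prob_space_distr) simp
  interpret AB: pair_prob_space DA DB ..
  \<comment> \<open>The identity, read as a random element of \<open>MA\<close> and of
    \<open>MB\<close>, generates \<open>\<A>\<close> and \<open>\<B>\<close> themselves, so
    independence of the two set systems becomes independence of two random elements.\<close>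
  have iv: "indep_var MA (\<lambda>x. x) MB (\<lambda>x. x)"
  proof -
    have "sigma_sets (space M) {(\<lambda>x. x) -` A \<inter> space M | A. A \<in> sets N} = sets N"
      if "space N = space M" for N
    proof -
      have "{(\<lambda>x. x) -` A \<inter> space M | A. A \<in> sets N} = sets N"
        using sets.sets_into_space[of _ N] that by (auto simp: Int_absorb2)
      then show ?thesis using sets.sigma_sets_eq[of N] that by simp
    qed
    from this[of MA] this[of MB] indep show ?thesis
      unfolding indep_var_eq by simp
  qed
  have D: "DA \<Otimes>\<^sub>M DB = distr M (MA \<Otimes>\<^sub>M MB) (\<lambda>x. (x, x))"
    using iv unfolding indep_var_distribution_eq DA_def DB_def by simp
  \<comment> \<open>Each event of the join is the trace on the diagonal of a set in the product of
    \<open>\<A>\<close> and \<open>\<V>\<close>. Using \<open>MV\<close> instead of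
    \<open>MB\<close> here puts the sections of \<open>C\<close> in \<open>\<V>\<close>, where the
    bound \<open>c\<close> is available.\<close>
  have "\<exists>C \<in> sets (MA \<Otimes>\<^sub>M MV). G = {\<omega> \<in> space M. (\<omega>, \<omega>) \<in> C}"
    using G
  proof induction
    case (Basic a)
    then show ?case
    proof
      assume "a \<in> \<A>"
      then show ?thesis
        using sets.sets_into_space[of a MA] pair_measureI[of a MA "space M" MV] sets.top[of MV]
        by (intro bexI[of _ "a \<times> space M"]) auto
    next
      assume "a \<in> \<V>"
      then show ?thesis
        using sets.sets_into_space[of a MV] pair_measureI[of "space M" MA a MV] sets.top[of MA]
        by (intro bexI[of _ "space M \<times> a"]) auto
    qed
  next
    case Empty
    then show ?case by (intro bexI[of _ "{}"]) auto
  next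
    case (Compl a)
    then obtain C where "C \<in> sets (MA \<Otimes>\<^sub>M MV)" "a = {\<omega> \<in> space M. (\<omega>, \<omega>) \<in> C}" by blast
    then show ?case
      using sets.compl_sets[of C "MA \<Otimes>\<^sub>M MV"]
      by (intro bexI[of _ "space M \<times> space M - C"]) (auto simp: space_pair_measure)
  next
    case (Union a)
    then have "\<forall>i. \<exists>C. C \<in> sets (MA \<Otimes>\<^sub>M MV) \<and> a i = {\<omega> \<in> space M. (\<omega>, \<omega>) \<in> C}"
      by blast
    from choice[OF this] obtain C where "\<And>i. C i \<in> sets (MA \<Otimes>\<^sub>M MV)"
        and "\<And>i. a i = {\<omega> \<in> space M. (\<omega>, \<omega>) \<in> C i}"
      by blast
    then show ?case by (intro bexI[of _ "\<Union>i. C i"]) auto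
  qed
  then obtain C where C: "C \<in> sets (MA \<Otimes>\<^sub>M MV)" and G_eq: "G = {\<omega> \<in> space M. (\<omega>, \<omega>) \<in> C}"
    by blast
  have section_in: "Pair x -` C \<in> \<V>" for x
    using sets_Pair1[OF C, of x] by simp
  \<comment> \<open>The product measure lives on \<open>MA\<close> and \<open>MB\<close>, so
    \<open>C\<close> must also be measurable for the finer second factor.\<close>
  have C' [measurable]: "C \<in> sets (MA \<Otimes>\<^sub>M MB)"
  proof -
    have "(\<lambda>p. (fst p, snd p)) \<in> MA \<Otimes>\<^sub>M MB \<rightarrow>\<^sub>M MA \<Otimes>\<^sub>M MV"
      by (intro measurable_Pair measurable_fst measurable_compose[OF measurable_snd BV])
    from measurable_sets[OF this C] sets.sets_into_space[OF C] show ?thesis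
      by (simp add: space_pair_measure Int_absorb2)
  qed
  have [measurable]: "H \<in> sets MB" "H \<in> events" using H sub by auto
  have [measurable]: "G \<in> events"
    unfolding G_eq by measurable
  have [measurable_cong]: "sets DA = sets MA" "sets DB = sets MB" by (simp_all add: DA_def DB_def)
  have PB: "B.prob V = prob V" if "V \<in> \<B>" for V
    using that sets.sets_into_space[of V MB] by (simp add: DB_def measure_distr Int_absorb2)
  \<comment> \<open>On the diagonal this integrates to the covariance of \<open>G\<close> and
    \<open>H\<close>; with \<open>x\<close> fixed, its integral over \<open>y\<close> is the
    covariance of a section of \<open>C\<close> with \<open>H\<close>.\<close>
  let ?\<phi> = "\<lambda>x y. indicator C (x, y) * (indicator H y - prob H)"
  have int: "integrable (DA \<Otimes>\<^sub>M DB) (\<lambda>(x, y). ?\<phi> x y)"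
    by (rule AB.integrable_const_bound[of _ 1])
      (auto simp: abs_mult intro!: AE_I2 mult_le_one abs_indicator_minus_prob_le_1)
  have inner: "(\<integral>y. ?\<phi> x y \<partial>DB) = prob ((Pair x -` C) \<inter> H) - prob (Pair x -` C) * prob H" for x
  proof -
    let ?V = "Pair x -` C"
    have V [measurable]: "?V \<in> sets MB" using section_in \<open>\<V> \<subseteq> \<B>\<close> by auto
    have "(\<integral>y. ?\<phi> x y \<partial>DB) = (\<integral>y. indicator (?V \<inter> H) y - prob H * indicator ?V y \<partial>DB)"
      by (intro Bochner_Integration.integral_cong) (auto simp: indicator_def)
    also have "\<dots> = B.prob (?V \<inter> H) - prob H * B.prob ?V"
      by (subst Bochner_Integration.integral_diff) (auto simp: B.emeasure_eq_measure)
    finally show ?thesis using V sets.Int[OF V, of H] H by (simp add: PB)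
  qed
  have "prob (G \<inter> H) - prob G * prob H = (\<integral>\<omega>. indicator (G \<inter> H) \<omega> - prob H * indicator G \<omega> \<partial>M)"
    by (subst Bochner_Integration.integral_diff) (auto simp: emeasure_eq_measure)
  also have "\<dots> = (\<integral>\<omega>. ?\<phi> \<omega> \<omega> \<partial>M)"
    by (intro Bochner_Integration.integral_cong) (auto simp: indicator_def G_eq)
  also have "\<dots> = (\<integral>p. (case p of (x, y) \<Rightarrow> ?\<phi> x y) \<partial>(DA \<Otimes>\<^sub>M DB))"
    unfolding D by (subst integral_distr) auto
  also have "\<dots> = (\<integral>x. (\<integral>y. ?\<phi> x y \<partial>DB) \<partial>DA)"
    using AB.integral_fst'[OF int] by simp
  finally have eq: "prob (G \<inter> H) - prob G * prob H = \<dots>" .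
  have int': "integrable DA (\<lambda>x. \<integral>y. ?\<phi> x y \<partial>DB)"
    using AB.integrable_fst'[OF int] by simp
  have "\<bar>\<integral>x. (\<integral>y. ?\<phi> x y \<partial>DB) \<partial>DA\<bar> \<le> (\<integral>x. \<bar>\<integral>y. ?\<phi> x y \<partial>DB\<bar> \<partial>DA)"
    by (rule integral_abs_bound)
  also have "\<dots> \<le> c"
    using int' by (intro A.integral_le_const AE_I2 integrable_abs) (simp_all add: inner le section_in)
  finally show ?thesis unfolding eq .
qed

end

section \<open>Measurability, coalescence and transfer of events for the iteration\<close>

lemma Z_iter_measurable:
  assumes f: "(\<lambda>(x, y, e). f x y e)
      \<in> borel \<Otimes>\<^sub>M (borel \<Otimes>\<^sub>M restrict_space borel {0..1}) \<rightarrow>\<^sub>M borel"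
    and x: "x \<in> N \<rightarrow>\<^sub>M borel"
    and Y: "\<And>k. s \<le> k \<Longrightarrow> Y k \<in> N \<rightarrow>\<^sub>M borel"
    and \<epsilon>: "\<And>k. s \<le> k \<Longrightarrow> \<epsilon> (Suc k) \<in> N \<rightarrow>\<^sub>M restrict_space borel {0..1}"
  shows "Z_iter f Y \<epsilon> x s t \<in> N \<rightarrow>\<^sub>M borel"
proof (induction t)
  case 0
  show ?case using x by (simp add: Z_iter.simps)
next
  case (Suc t)
  note [measurable] = Suc
  show ?case
  proof (cases "Suc t \<le> s")
    case True
    then show ?thesis using x by (simp add: Z_iter.simps)
  next
    case False
    then have [measurable]: "Y t \<in> N \<rightarrow>\<^sub>M borel" "\<epsilon> (Suc t) \<in> N \<rightarrow>\<^sub>M restrict_space borel {0..1}"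
      using Y \<epsilon> by auto
    have "(\<lambda>\<omega>. (Z_iter f Y \<epsilon> x s t \<omega>, Y t \<omega>, \<epsilon> (Suc t) \<omega>))
        \<in> N \<rightarrow>\<^sub>M borel \<Otimes>\<^sub>M (borel \<Otimes>\<^sub>M restrict_space borel {0..1})"
      by measurable
    from measurable_compose[OF this f] show ?thesis
      using False by (simp add: Z_iter.simps[of _ _ _ _ _ "Suc t"])
  qed
qed

text \<open>Both paths use the same inputs, so after meeting they stay together. Thus a single
  disagreement event at one time controls all later times.\<close>

lemma Z_iter_coalesce:
  assumes "s \<le> t" "t \<le> k" "Z_iter f Y \<epsilon> x s t \<omega> = Z_iter f Y \<epsilon> x' s t \<omega>"
  shows "Z_iter f Y \<epsilon> x s k \<omega> = Z_iter f Y \<epsilon> x' s k \<omega>"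
  using assms(2)
proof (induction k rule: dec_induct)
  case (step k)
  then show ?case using assms(1) by (simp add: Z_iter.simps[of _ _ _ _ _ "Suc k"])
qed (rule assms(3))

lemma Z_iter_eq_process:
  assumes "\<And>t. X (Suc t) \<omega> = f (X t \<omega>) (Y t \<omega>) (\<epsilon> (Suc t) \<omega>)" "s \<le> t"
  shows "Z_iter f Y \<epsilon> (X s) s t \<omega> = X t \<omega>"
  using assms(2)
proof (induction t rule: dec_induct)
  case base
  show ?case by (simp add: Z_iter.simps)
next
  case (step k)
  then show ?case by (simp add: Z_iter.simps[of _ _ _ _ _ "Suc k"] assms(1))
qed

text \<open>Agreement off \<open>D\<close> holds for the generators and survives complements and
  countable unions, with the same \<open>D\<close> throughout.\<close>

lemma sigma_process_transfer:
  assumes eq: "\<And>k \<omega>. k \<in> I \<Longrightarrow> \<omega> \<in> space M - D \<Longrightarrow> W k \<omega> = W' k \<omega>"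
    and H: "H \<in> sigma_process M W I"
  shows "\<exists>H' \<in> sigma_process M W' I. H - D = H' - D"
  using H[unfolded sigma_process_def]
proof induction
  case (Basic a)
  then obtain k A where "k \<in> I" "A \<in> sets borel" "a = W k -` A \<inter> space M" by blast
  moreover have "W' k -` A \<inter> space M \<in> sigma_process M W' I"
    using calculation(1,2) measurable_sets[OF measurable_process_algebra, of k I A W' M] by simp
  ultimately show ?case
    using eq by (intro bexI[of _ "W' k -` A \<inter> space M"]) auto
next
  case Empty
  show ?case unfolding sigma_process_def by (auto intro: sigma_sets.Empty)
next
  case (Compl a)
  then obtain H' where "H' \<in> sigma_process M W' I" "a - D = H' - D" by blast
  then show ?case
    unfolding sigma_process_def
    by (intro bexI[of _ "space M - H'"] sigma_sets.Compl) blast+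
next
  case (Union a)
  then obtain H' where "\<And>i. H' i \<in> sigma_process M W' I" "\<And>i. a i - D = H' i - D" by metis
  then show ?case
    unfolding sigma_process_def
    by (intro bexI[of _ "\<Union>i. H' i"] sigma_sets.Union) blast+
qed

section \<open>Combination of the coupling and mixing estimates\<close>

theorem lemma1p2:
  fixes M :: "'w measure"
    and f :: "'x::polish_space \<Rightarrow> 'y::polish_space \<Rightarrow> real \<Rightarrow> 'x"
    and Y :: "nat \<Rightarrow> 'w \<Rightarrow> 'y"
    and \<epsilon> :: "nat \<Rightarrow> 'w \<Rightarrow> real"
    and X :: "nat \<Rightarrow> 'w \<Rightarrow> 'x"
    and x\<^sub>0 :: 'x
    and m n :: nat
  defines "Yt \<equiv> \<lambda>k \<omega>. (Y k \<omega>, \<epsilon> (Suc k) \<omega>)"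
  assumes "prob_space M"
    and "(\<lambda>(x, y, e). f x y e)
      \<in> borel \<Otimes>\<^sub>M (borel \<Otimes>\<^sub>M restrict_space borel {0..1}) \<rightarrow>\<^sub>M borel"
    and "\<And>t. Y t \<in> M \<rightarrow>\<^sub>M borel"
    and "\<And>t. t \<ge> 1 \<Longrightarrow> \<epsilon> t \<in> M \<rightarrow>\<^sub>M restrict_space borel {0..1}"
    and "X 0 \<in> M \<rightarrow>\<^sub>M borel"
    and "prob_space.indep_set M (sigma_process M X {0}) (sigma_process M Yt UNIV)"
    and "\<And>t \<omega>. \<omega> \<in> space M \<Longrightarrow> X (Suc t) \<omega> = f (X t \<omega>) (Y t \<omega>) (\<epsilon> (Suc t) \<omega>)"
    and "coupling_bound M f Y \<epsilon> X x\<^sub>0 \<longlonglongrightarrow> 0"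
    and "m < n"
  shows "alpha_mixing M X n
    \<le> alpha_mixing M Yt (m + 1) + coupling_bound M f Y \<epsilon> X x\<^sub>0 (n - m)"
proof -
  interpret prob_space M by fact
  note f = assms(3) and Y = assms(4) and \<epsilon> = assms(5) and X0 = assms(6) and indep = assms(7)
    and step = assms(8)
  let ?P = "process_algebra M Yt"
  have Y_P: "Y k \<in> ?P I \<rightarrow>\<^sub>M borel" if "k \<in> I" for k I
  proof -
    \<comment> \<open>\<open>Yt\<close> is measurable for the Borel sets of the product type, and
      the continuous projections recover its components.\<close>
    have "(\<lambda>\<omega>. fst (Yt k \<omega>)) \<in> ?P I \<rightarrow>\<^sub>M borel"
      by (intro measurable_compose[OF measurable_process_algebra[where W = Yt, OF that]]
          borel_measurable_continuous_onI continuous_intros)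
    then show ?thesis by (simp add: Yt_def)
  qed
  have \<epsilon>_P: "\<epsilon> (Suc k) \<in> ?P I \<rightarrow>\<^sub>M restrict_space borel {0..1}" if "k \<in> I" for k I
  proof (rule measurable_restrict_space2)
    show "\<epsilon> (Suc k) \<in> space (?P I) \<rightarrow> {0..1}"
      using measurable_space[OF \<epsilon>[of "Suc k"]] by (auto simp: space_restrict_space)
    have "(\<lambda>\<omega>. snd (Yt k \<omega>)) \<in> ?P I \<rightarrow>\<^sub>M borel"
      by (intro measurable_compose[OF measurable_process_algebra[where W = Yt, OF that]]
          borel_measurable_continuous_onI continuous_intros)
    then show "\<epsilon> (Suc k) \<in> ?P I \<rightarrow>\<^sub>M borel" by (simp add: Yt_def)
  qed
  have X_eq: "Z_iter f Y \<epsilon> (X s) s t \<omega> = X t \<omega>" if "\<omega> \<in> space M" "s \<le> t" for s t \<omega>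
    using step that by (intro Z_iter_eq_process) auto
  have X_meas [measurable]: "X k \<in> M \<rightarrow>\<^sub>M borel" for k
  proof -
    have "Z_iter f Y \<epsilon> (X 0) 0 k \<in> M \<rightarrow>\<^sub>M borel"
      using Y \<epsilon> X0 by (intro Z_iter_measurable[OF f]) auto
    then show ?thesis by (subst measurable_cong[OF X_eq[symmetric]]) auto
  qed
  have Yt_events: "sigma_process M Yt I \<subseteq> events" for I
    using sigma_process_mono[of I UNIV M Yt] indep_setD_ev2[OF indep] by auto
  \<comment> \<open>The index set is \<open>{..<j}\<close> because \<open>X j\<close> is built from
    \<open>Yt 0\<close> to \<open>Yt (j - 1)\<close>; this is the source of the extra 1 in the gap
    \<open>m + 1\<close>.\<close>
  have past: "sigma_process M X {0..j} \<subseteq> sigma_sets (space M) (sigma_process M X {0} \<union> sigma_process M Yt {..<j})"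
    for j
  proof -
    let ?S = "sigma_process M X {0} \<union> sigma_process M Yt {..<j}"
    let ?N = "sigma (space M) ?S"
    have S: "?S \<subseteq> Pow (space M)"
      using sets.space_closed[of "process_algebra M X {0}"] sets.space_closed[of "?P {..<j}"] by simp
    note lift = subsetD[OF measurable_mono1[OF S]]
    have "X k \<in> ?N \<rightarrow>\<^sub>M borel" if "k \<le> j" for k
      using that
    proof (induction k)
      case 0
      show ?case by (rule lift[OF _ measurable_process_algebra[of 0 "{0}"]]) auto
    next
      case (Suc k)
      have "Y k \<in> ?N \<rightarrow>\<^sub>M borel" "\<epsilon> (Suc k) \<in> ?N \<rightarrow>\<^sub>M restrict_space borel {0..1}"
        using Suc.prems by (auto intro!: lift[OF _ Y_P[of k "{..<j}"]] lift[OF _ \<epsilon>_P[of k "{..<j}"]])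
      with Suc have "(\<lambda>\<omega>. (X k \<omega>, Y k \<omega>, \<epsilon> (Suc k) \<omega>))
          \<in> ?N \<rightarrow>\<^sub>M borel \<Otimes>\<^sub>M (borel \<Otimes>\<^sub>M restrict_space borel {0..1})"
        by (intro measurable_Pair) auto
      from measurable_compose[OF this f] show ?case
        by (subst measurable_cong[OF step]) (auto simp: space_measure_of_conv)
    qed
    then have "sigma_process M X {0..j} \<subseteq> sets ?N"
      by (intro sigma_process_subset) (auto simp: space_measure_of_conv)
    then show ?thesis using S by simp
  qed
  show ?thesis
    unfolding alpha_mixing_def[of M X]
  proof (intro cSUP_least alpha_sigma_least empty_in_sigma_process)
    fix j G H
    assume G: "G \<in> sigma_process M X {0..j}" and H: "H \<in> sigma_process M X {j + n..}"
    \<comment> \<open>A restart at \<open>j + m\<close> leaves \<open>n - m\<close> steps until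
      \<open>j + n\<close>. The supremum in \<open>coupling_bound\<close> runs over all starting
      times, hence covers \<open>s\<close>.\<close>
    define s where "s = j + m"
    have s: "s + (n - m) = j + n" using \<open>m < n\<close> by (simp add: s_def)
    let ?Z = "Z_iter f Y \<epsilon> (\<lambda>_. x\<^sub>0) s"
    define D where "D = {\<omega> \<in> space M. Z_iter f Y \<epsilon> (X s) s (j + n) \<omega> \<noteq> ?Z (j + n) \<omega>}"
    have D_le: "prob D \<le> coupling_bound M f Y \<epsilon> X x\<^sub>0 (n - m)"
      using prob_diff_le_coupling_bound[of f Y \<epsilon> X s "n - m" x\<^sub>0] unfolding D_def s .
    have [measurable]: "Z_iter f Y \<epsilon> (X s) s (j + n) \<in> M \<rightarrow>\<^sub>M borel" "?Z (j + n) \<in> M \<rightarrow>\<^sub>M borel"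
      using Y \<epsilon> X_meas by (auto intro!: Z_iter_measurable[OF f])
    have D: "D \<in> events" unfolding D_def by measurable
    have s_le: "s \<le> j + n" using s by linarith
    have "X k \<omega> = ?Z k \<omega>" if k: "k \<in> {j + n..}" and \<omega>: "\<omega> \<in> space M - D" for k \<omega>
    proof -
      have "X k \<omega> = Z_iter f Y \<epsilon> (X s) s k \<omega>"
        using X_eq[of \<omega> s k] k \<omega> s_le by simp
      also have "\<dots> = ?Z k \<omega>"
      proof (rule Z_iter_coalesce[OF s_le])
        show "Z_iter f Y \<epsilon> (X s) s (j + n) \<omega> = ?Z (j + n) \<omega>" using \<omega> unfolding D_def by blast
      qed (use k in simp)
      finally show ?thesis .
    qed
    from sigma_process_transfer[OF this H]
    obtain H' where H': "H' \<in> sigma_process M ?Z {j + n..}" and HH': "H - D = H' - D" by blast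
    \<comment> \<open>The start is constant and \<open>Z_iter_measurable\<close> asks only for
      inputs from time \<open>s\<close> on, so the restarted path forgets everything before
      \<open>s\<close>.\<close>
    have "?Z k \<in> ?P {s..} \<rightarrow>\<^sub>M borel" for k
      by (intro Z_iter_measurable[OF f] Y_P \<epsilon>_P) auto
    then have "sigma_process M ?Z {j + n..} \<subseteq> sigma_process M Yt {s..}"
      using sigma_process_subset[of "{j + n..}" ?Z "?P {s..}" M] by simp
    with H' have H'_Yt: "H' \<in> sigma_process M Yt {s..}" by blast
    then have H'_ev: "H' \<in> events" using Yt_events by blast
    have G_ev: "G \<in> events" and H_ev: "H \<in> events"
      using G H sigma_process_subset[of _ X M M] X_meas by blast+
    have V_le: "\<bar>prob (V \<inter> H') - prob V * prob H'\<bar> \<le> alpha_mixing M Yt (m + 1)"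
      if V: "V \<in> sigma_process M Yt {..<j}" for V
    proof (cases j)
      \<comment> \<open>No input precedes time 0, so the past of \<open>Yt\<close> is trivial and
        the covariance vanishes.\<close>
      case 0
      then have "V \<in> {{}, space M}"
        using V by (simp add: sigma_process_def sigma_sets_empty_eq)
      then have "prob (V \<inter> H') - prob V * prob H' = 0"
        using sets.Int_space_eq1[OF H'_ev] by (auto simp: prob_space)
      then show ?thesis using alpha_mixing_nonneg[of Yt] by simp
    next
      case (Suc i)
      \<comment> \<open>The last past input has index \<open>i = j - 1\<close> and the first future
        one has index \<open>j + m\<close>, a gap of \<open>m + 1\<close>.\<close>
      have "{..<j} = {0..i}" "s = i + (m + 1)" using Suc by (auto simp: s_def)
      then show ?thesis
        using alpha_sigma_upper[OF V H'_Yt] alpha_mixing_upper[of Yt i "m + 1"] by simp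
    qed
    have "G \<in> sigma_sets (space M) (sigma_process M X {0} \<union> sigma_process M Yt {..<j})"
      using past G by blast
    moreover have "H' \<in> sigma_process M Yt UNIV"
      using H'_Yt sigma_process_mono[OF subset_UNIV] by blast
    ultimately have "\<bar>prob (G \<inter> H') - prob G * prob H'\<bar> \<le> alpha_mixing M Yt (m + 1)"
      using cov_le_join_indep[OF indep sigma_algebra_sigma_process sigma_algebra_sigma_process
          sigma_algebra_sigma_process sigma_process_mono[OF subset_UNIV] _ _ V_le] by simp
    with cov_perturb[OF G_ev H_ev H'_ev D HH'] D_le
    show "\<bar>prob (G \<inter> H) - prob G * prob H\<bar>
        \<le> alpha_mixing M Yt (m + 1) + coupling_bound M f Y \<epsilon> X x\<^sub>0 (n - m)"
      by linarith
  qed auto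
qed

end
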